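(* Let $p\in(2,\infty]$ and fix positive integers $m,n,T,r$ with $T\ge r$, $m=2n$ and $n\ge T$. Let $w_p(T,r)\in\mathbb{R}^T$ be any vector with $\|w_p(T,r)\|_p\le1$ and $$\sum_{i=1}^{r}\left[\sum_{\ell=1}^{T-r+i}(w_p(T,r))_\ell^2\right]^{-1}=D_p(T,r).$$ Let $z_i=e^{2\pi j i/n}$ for $i=0,\dots,n-1$, where $j=\sqrt{-1}$, and define $u_0,\dots,u_{2n-1}\in\mathbb{R}^T$ by $$u_i=\mathrm{Re}\{w_p(T,r)\odot\varphi(z_i)\},\qquad u_{n+i}=\mathrm{Im}\{w_p(T,r)\odot\varphi(z_i)\},\qquad i=0,\dots,n-1.$$ Then the matrix $\Sigma(u)=\sum_{k=0}^{2n-1}\mathrm{Toep}(u_k)^{\top}\mathrm{Toep}(u_k)$ satisfies $$\mathrm{Tr}\big([\Sigma(u)^{-1}]_{[r]}\big)=\frac2m\,D_p(T,r).$$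
   Context: $D_p(T,r):=\inf\left\{\sum_{i=1}^{r}\left[\sum_{\ell=1}^{T-r+i}w_\ell\right]^{-1}:\ w\in\mathbb{R}^T,\ w\ge0,\ \|w\|_{p/2}\le1\right\}$ (with $p/2=\infty$ when $p=\infty$ and $0^{-1}=+\infty$). For $v\in\mathbb{R}^T$, $\mathrm{Toep}(v)$ is the $T\times T$ lower-triangular Toeplitz matrix with first column $v$. For a $T\times T$ matrix $M$, $[M]_{[r]}$ is its upper-left $r\times r$ block. $\varphi(z)=(1,z,\dots,z^{T-1})\in\mathbb{C}^T$; $\odot$ is the entrywise product; real and imaginary parts are entrywise. *)

theory Defs
  imports Complex_Main "HOL-Library.Extended_Real"
    "Jordan_Normal_Form.Gauss_Jordan_Elimination"
begin

text \<open>Vectors and matrices are indexed from 0, so the mathematical entry $v_\ell$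
  (with $1 \le \ell \le T$) is entry $\ell - 1$ here.\<close>

text \<open>The exponent is an extended real, so that \<open>\<infinity> / 2 = \<infinity>\<close>. The inserted \<open>0\<close> only
  matters for the vector of dimension 0.\<close>

definition lp_norm :: "ereal \<Rightarrow> real vec \<Rightarrow> real" where
  "lp_norm p v =
     (if p = \<infinity> then Max (insert 0 ((\<lambda>l. \<bar>v $ l\<bar>) ` {..<dim_vec v}))
      else (\<Sum>l<dim_vec v. \<bar>v $ l\<bar> powr real_of_ereal p) powr (1 / real_of_ereal p))"

text \<open>The sums and the infimum are taken in \<^typ>\<open>ereal\<close>, where \<open>inverse 0 = \<infinity>\<close>.\<close>

definition D :: "ereal \<Rightarrow> nat \<Rightarrow> nat \<Rightarrow> ereal" where
  "D p T r =
     Inf {(\<Sum>i=1..r. inverse (ereal (\<Sum>l<T - r + i. w $ l))) | w.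
            w \<in> carrier_vec T \<and> (\<forall>l<T. 0 \<le> w $ l) \<and> lp_norm (p / 2) w \<le> 1}"

definition Toep :: "real vec \<Rightarrow> real mat" where
  "Toep v = mat (dim_vec v) (dim_vec v) (\<lambda>(a, b). if b \<le> a then v $ (a - b) else 0)"

definition phi :: "nat \<Rightarrow> complex \<Rightarrow> complex vec" where
  "phi T z = vec T (\<lambda>l. z ^ l)"

definition hadamard_vec :: "'a::times vec \<Rightarrow> 'a vec \<Rightarrow> 'a vec" where
  "hadamard_vec v w = vec (dim_vec v) (\<lambda>l. v $ l * w $ l)"

definition Sigma_mat :: "nat \<Rightarrow> nat \<Rightarrow> (nat \<Rightarrow> real vec) \<Rightarrow> real mat" where
  "Sigma_mat T m u =
     mat T T (\<lambda>(a, b). \<Sum>k<m. (transpose_mat (Toep (u k)) * Toep (u k)) $$ (a, b))"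

definition upper_left :: "nat \<Rightarrow> 'a mat \<Rightarrow> 'a mat" where
  "upper_left r M = mat r r (\<lambda>(a, b). M $$ (a, b))"

definition mat_trace :: "'a::comm_monoid_add mat \<Rightarrow> 'a" where
  "mat_trace M = (\<Sum>a<dim_row M. M $$ (a, a))"

end

theory Submission
  imports Defs
begin

text \<open>Summing over the roots of unity makes the shifted entries of the \<open>u k\<close> orthogonal, so
  \<open>Sigma_mat\<close> is diagonal and its entry at \<open>a\<close> is \<open>n\<close> times the sum of the first \<open>T - a\<close> squared
  weights; the trace formula is then immediate as soon as no diagonal entry vanishes, that is, as
  soon as \<open>w $ 0 \<noteq> 0\<close>. For \<open>r < T\<close> the finiteness of \<open>D p T r\<close> does not give this, but optimality
  does. If the squared weight at \<open>0\<close> were zero, sharing a positive squared weight \<open>x\<close> (at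
  some later position) between its position and \<open>0\<close>, as \<open>c\<close> and \<open>c\<close> with
  \<open>c = x \<cdot> 2 powr (- 1 / q)\<close> and \<open>q = p / 2 > 1\<close>, would preserve the norm and, because \<open>c + c > x\<close>,
  strictly increase every prefix sum.\<close>

section \<open>Unit balls of the norms for finite and infinite exponents\<close>

lemma lp_norm_infty_le_1_iff:
  "lp_norm \<infinity> v \<le> 1 \<longleftrightarrow> (\<forall>l<dim_vec v. \<bar>v $ l\<bar> \<le> 1)"
  by (auto simp: lp_norm_def)

lemma lp_norm_real_le_1_iff:
  assumes "0 < p"
  shows "lp_norm (ereal p) v \<le> 1 \<longleftrightarrow> (\<Sum>l<dim_vec v. \<bar>v $ l\<bar> powr p) \<le> 1"
proof -
  let ?s = "\<Sum>l<dim_vec v. \<bar>v $ l\<bar> powr p"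
  have s: "0 \<le> ?s" by (simp add: sum_nonneg)
  have "?s powr (1 / p) \<le> 1 \<longleftrightarrow> ?s \<le> 1"
  proof
    assume "?s \<le> 1"
    then show "?s powr (1 / p) \<le> 1"
      using powr_mono2[of "1 / p" ?s 1] s assms by simp
  next
    assume h: "?s powr (1 / p) \<le> 1"
    show "?s \<le> 1"
    proof (rule ccontr)
      assume "\<not> ?s \<le> 1"
      then have "1 powr (1 / p) < ?s powr (1 / p)"
        using assms by (intro powr_less_mono2) auto
      with h show False by simp
    qed
  qed
  then show ?thesis by (simp add: lp_norm_def)
qed

text \<open>Makes the squared weights admissible in the infimum \<open>D p T r\<close>. For finite
  exponents the two norm sums agree term by term; for \<infinity> both bounds say that every entry
  has modulus at most 1.\<close>

lemma lp_norm_squares_le_1: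
  assumes "2 < p" and "lp_norm p w \<le> 1"
  shows "lp_norm (p / 2) (map_vec (\<lambda>x. x\<^sup>2) w) \<le> 1"
proof (cases p)
  case (real q)
  have q: "2 < q" using assms(1) real by simp
  have p2: "p / 2 = ereal (q / 2)" using real by simp
  have "(x\<^sup>2) powr (q / 2) = \<bar>x\<bar> powr q" for x :: real
  proof -
    have "(x\<^sup>2) powr (q / 2) = (\<bar>x\<bar> powr 2) powr (q / 2)" by simp
    also have "\<dots> = \<bar>x\<bar> powr q" by (subst powr_powr) simp
    finally show ?thesis .
  qed
  then show ?thesis
    using assms(2) q unfolding p2 real by (simp add: lp_norm_real_le_1_iff)
next
  case PInf
  then show ?thesis
    using assms(2) by (simp add: lp_norm_infty_le_1_iff abs_square_le_1)
qed (use assms in auto)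

section \<open>Increasing all prefix sums of weights that vanish at index 0\<close>

lemma split_entry_lp_norm_le_1:
  assumes q: "1 < q" and v: "v \<in> carrier_vec T" and norm: "lp_norm q v \<le> 1"
    and v0: "v $ 0 = 0" and j: "j < T" and vj: "0 < v $ j"
  obtains c where "0 < c" "v $ j < 2 * c"
    "lp_norm q (vec T (\<lambda>l. if l = 0 \<or> l = j then c else v $ l)) \<le> 1"
proof (cases q)
  case (real s)
  have s: "1 < s" using q real by simp
  define c where "c = v $ j * 2 powr (- 1 / s)"
  have c: "0 < c" using vj by (simp add: c_def)
  \<comment> \<open>Here \<open>1 < s\<close> enters: it makes \<open>2 powr (1 - 1 / s)\<close>
    exceed 1, so two copies of \<open>c\<close> outweigh the entry they replace.\<close>
  have "2 powr (-1) < (2::real) powr (- 1 / s)"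
    using s by (intro powr_less_mono) (auto simp: field_simps)
  then have "v $ j * 1 < v $ j * (2 * 2 powr (- 1 / s))"
    using vj by (intro mult_strict_left_mono) (auto simp: powr_minus)
  then have gt: "v $ j < 2 * c" by (simp add: c_def mult_ac)
  have cs: "2 * c powr s = (v $ j) powr s"
    using vj s by (simp add: c_def powr_mult powr_powr)
  have j0: "j \<noteq> 0" using v0 vj by (metis less_irrefl)
  let ?u = "\<lambda>l. if l = 0 \<or> l = j then c else v $ l"
  have split: "(\<Sum>l<T. f l) = f 0 + f j + (\<Sum>l\<in>{..<T} - {0, j}. f l)" for f :: "nat \<Rightarrow> real"
  proof -
    have "(\<Sum>l<T. f l) = (\<Sum>l\<in>{..<T} - {0, j}. f l) + (\<Sum>l\<in>{0, j}. f l)"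
      using j by (intro sum.subset_diff) auto
    then show ?thesis using j0 by simp
  qed
  have "(\<Sum>l<T. \<bar>?u l\<bar> powr s) = (\<Sum>l<T. \<bar>v $ l\<bar> powr s)"
    unfolding split using c cs v0 vj s by simp
  then have "lp_norm q (vec T ?u) \<le> 1"
    using norm v s unfolding real by (simp add: lp_norm_real_le_1_iff)
  with c gt show thesis by (rule that)
next
  case PInf
  \<comment> \<open>The maximum norm allows duplicating the entry without rescaling, the limit of
    \<open>2 powr (- 1 / s)\<close> being 1.\<close>
  have "lp_norm q (vec T (\<lambda>l. if l = 0 \<or> l = j then v $ j else v $ l)) \<le> 1"
    using norm v j unfolding PInf by (auto simp: lp_norm_infty_le_1_iff)
  with vj show thesis by (intro that[of "v $ j"]) auto
qed (use q in auto)

lemma unit_vec_lp_norm_le_1: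
  assumes "1 < q" and "0 < T"
  shows "lp_norm q (unit_vec T 0) \<le> 1"
proof (cases q)
  case (real s)
  have "(\<Sum>l<T. \<bar>unit_vec T 0 $ l\<bar> powr s) = (\<Sum>l<T. if l = 0 then 1 else 0)"
    using assms real by (intro sum.cong) (auto simp: unit_vec_def)
  then show ?thesis
    using assms real by (simp add: lp_norm_real_le_1_iff)
next
  case PInf
  then show ?thesis by (auto simp: lp_norm_infty_le_1_iff unit_vec_def)
qed (use assms in auto)

text \<open>A positive entry can be shared with index 0; if there is none, all prefix sums are 0 and
  \<open>unit_vec T 0\<close> beats them.\<close>

lemma prefix_sums_improvable:
  assumes q: "1 < q" and T: "0 < T" and v: "v \<in> carrier_vec T"
    and nonneg: "\<And>l. l < T \<Longrightarrow> 0 \<le> v $ l" and norm: "lp_norm q v \<le> 1" and v0: "v $ 0 = 0"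
  obtains v' where "v' \<in> carrier_vec T" "\<And>l. l < T \<Longrightarrow> 0 \<le> v' $ l" "lp_norm q v' \<le> 1"
    "\<And>k. 0 < k \<Longrightarrow> k \<le> T \<Longrightarrow> (\<Sum>l<k. v $ l) < (\<Sum>l<k. v' $ l)"
proof (cases "\<exists>j<T. 0 < v $ j")
  case True
  then obtain j where j: "j < T" and vj: "0 < v $ j" by blast
  obtain c where c: "0 < c" "v $ j < 2 * c"
    and n: "lp_norm q (vec T (\<lambda>l. if l = 0 \<or> l = j then c else v $ l)) \<le> 1"
    using split_entry_lp_norm_le_1[OF q v norm v0 j vj] .
  let ?v = "vec T (\<lambda>l. if l = 0 \<or> l = j then c else v $ l)"
  have j0: "j \<noteq> 0" using v0 vj by (metis less_irrefl)
  have "(\<Sum>l<k. v $ l) < (\<Sum>l<k. ?v $ l)" if k: "0 < k" "k \<le> T" for k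
  proof -
    have "(\<Sum>l<k. ?v $ l) - (\<Sum>l<k. v $ l)
        = (\<Sum>l<k. (if l = 0 then c else 0) + (if l = j then c - v $ j else 0))"
      unfolding sum_subtractf[symmetric]
      using k j0 v0 by (intro sum.cong) auto
    \<comment> \<open>A prefix that stops before \<open>j\<close> gains \<open>c\<close>; one that
      contains \<open>j\<close> gains \<open>2 * c - v $ j\<close>.\<close>
    also have "\<dots> = c + (if j < k then c - v $ j else 0)"
      using k by (simp add: sum.distrib)
    also have "\<dots> > 0" using c by simp
    finally show ?thesis by simp
  qed
  then show thesis using c nonneg n by (intro that[of ?v]) (auto simp: j0)
next
  case False
  then have zero: "v $ l = 0" if "l < T" for l using nonneg[OF that] that by force
  have "(\<Sum>l<k. v $ l) < (\<Sum>l<k. unit_vec T 0 $ l)" if k: "0 < k" "k \<le> T" for k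
  proof -
    have "(\<Sum>l<k. unit_vec T 0 $ l) = (\<Sum>l<k. if l = 0 then 1 else 0 :: real)"
      using k by (intro sum.cong) (auto simp: unit_vec_def)
    moreover have "(\<Sum>l<k. v $ l) = 0"
      using k zero by (intro sum.neutral) auto
    ultimately show ?thesis using k by simp
  qed
  then show thesis
    using T unit_vec_lp_norm_le_1[OF q T] by (intro that[of "unit_vec T 0"]) (auto simp: unit_vec_def)
qed

text \<open>Every \<open>t i\<close> is positive, so the left sum is finite. A vanishing
  \<open>s i\<close> makes the right sum \<infinity>; otherwise both sums are real and compare
  termwise.\<close>

lemma sum_inverse_ereal_strict_antimono:
  fixes s t :: "'a \<Rightarrow> real"
  assumes "finite A" "A \<noteq> {}" "\<And>i. i \<in> A \<Longrightarrow> 0 \<le> s i" "\<And>i. i \<in> A \<Longrightarrow> s i < t i"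
  shows "(\<Sum>i\<in>A. inverse (ereal (t i))) < (\<Sum>i\<in>A. inverse (ereal (s i)))"
proof -
  have t: "0 < t i" if "i \<in> A" for i using assms(3,4)[OF that] by simp
  have lhs: "(\<Sum>i\<in>A. inverse (ereal (t i))) = ereal (\<Sum>i\<in>A. inverse (t i))"
    unfolding sum_ereal[symmetric] by (intro sum.cong refl) (simp add: less_imp_neq[OF t, symmetric])
  show ?thesis
  proof (cases "\<exists>i\<in>A. s i = 0")
    case True
    then have "(\<Sum>i\<in>A. inverse (ereal (s i))) = \<infinity>"
      using assms(1) by (auto simp: sum_Pinfty)
    then show ?thesis unfolding lhs by simp
  next
    case False
    then have s: "0 < s i" if "i \<in> A" for i using assms(3)[OF that] that by force
    have "(\<Sum>i\<in>A. inverse (ereal (s i))) = ereal (\<Sum>i\<in>A. inverse (s i))"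
      unfolding sum_ereal[symmetric] by (intro sum.cong refl) (simp add: less_imp_neq[OF s, symmetric])
    moreover have "(\<Sum>i\<in>A. inverse (t i)) < (\<Sum>i\<in>A. inverse (s i))"
      using assms s by (intro sum_strict_mono less_imp_inverse_less) auto
    ultimately show ?thesis unfolding lhs by simp
  qed
qed

lemma minimizer_first_entry_nonzero:
  assumes p: "2 < p" and r: "0 < r" "r \<le> T" and w: "w \<in> carrier_vec T"
    and norm: "lp_norm p w \<le> 1"
    and opt: "(\<Sum>i=1..r. inverse (ereal (\<Sum>l<T - r + i. (w $ l)\<^sup>2))) = D p T r"
  shows "w $ 0 \<noteq> 0"
proof
  assume w0: "w $ 0 = 0"
  let ?v = "map_vec (\<lambda>x. x\<^sup>2) w"
  have q: "1 < p / 2"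
    using p by (cases p) auto
  obtain v where v: "v \<in> carrier_vec T" "\<And>l. l < T \<Longrightarrow> 0 \<le> v $ l" "lp_norm (p / 2) v \<le> 1"
    and less: "\<And>k. 0 < k \<Longrightarrow> k \<le> T \<Longrightarrow> (\<Sum>l<k. ?v $ l) < (\<Sum>l<k. v $ l)"
    using prefix_sums_improvable[OF q _ _ _ lp_norm_squares_le_1[OF p norm], of T] w w0 r by auto
  have "(\<Sum>l<k. ?v $ l) = (\<Sum>l<k. (w $ l)\<^sup>2)" if "k \<le> T" for k
    using that w by (intro sum.cong) auto
  then have less': "(\<Sum>l<k. (w $ l)\<^sup>2) < (\<Sum>l<k. v $ l)" if "0 < k" "k \<le> T" for k
    using less[OF that] that by simp
  have "D p T r \<le> (\<Sum>i=1..r. inverse (ereal (\<Sum>l<T - r + i. v $ l)))"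
    unfolding D_def using v by (intro Inf_lower) blast
  \<comment> \<open>As \<open>1 \<le> i \<le> r\<close>, each prefix length \<open>T - r + i\<close>
    lies between 1 and \<open>T\<close>, where the improvement is strict.\<close>
  also have "\<dots> < (\<Sum>i=1..r. inverse (ereal (\<Sum>l<T - r + i. (w $ l)\<^sup>2)))"
    using r by (intro sum_inverse_ereal_strict_antimono less') (auto simp: sum_nonneg)
  finally show False using opt by simp
qed

section \<open>Orthogonality over the roots of unity and the diagonal form of
  \<open>Sigma_mat\<close>\<close>

lemma sum_roots_of_unity_orthogonal:
  fixes n s t :: nat
  assumes "s < n" "t < n"
  defines "\<zeta> \<equiv> \<lambda>i. cis (2 * pi * real i / real n)"
  shows "(\<Sum>i<n. \<zeta> i ^ s * cnj (\<zeta> i ^ t)) = (if s = t then of_nat n else 0)"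
proof -
  define x where "x = \<zeta> s * cnj (\<zeta> t)"
  \<comment> \<open>Exchanging index and exponent turns the sum into a geometric one whose ratio
    \<open>x\<close> is an \<open>n\<close>-th root of unity.\<close>
  have swap: "\<zeta> i ^ k = \<zeta> k ^ i" for i k
    by (simp add: \<zeta>_def Complex.DeMoivre mult_ac)
  have sum: "(\<Sum>i<n. \<zeta> i ^ s * cnj (\<zeta> i ^ t)) = (\<Sum>i<n. x ^ i)"
    by (simp add: swap[of _ s] swap[of _ t] x_def power_mult_distrib)
  have unit: "\<zeta> k * cnj (\<zeta> k) = 1" "\<zeta> k ^ n = 1" for k
    using assms by (simp_all add: \<zeta>_def cis_cnj cis_mult swap[unfolded \<zeta>_def, of k n])
  show ?thesis
  proof (cases "s = t")
    case True
    then show ?thesis unfolding sum by (simp add: x_def unit)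
  next
    case False
    \<comment> \<open>Since \<open>s\<close> and \<open>t\<close> are below \<open>n\<close>,
      distinct exponents give distinct roots; hence the ratio is not 1 and the geometric sum
      vanishes.\<close>
    have "inj_on \<zeta> {..<n}"
      using bij_betw_roots_unity[of n] assms by (auto simp: \<zeta>_def bij_betw_def)
    then have ne: "\<zeta> s \<noteq> \<zeta> t" using False assms by (auto dest: inj_onD)
    have "x \<noteq> 1"
    proof
      assume "x = 1"
      then have "\<zeta> t = \<zeta> s * (\<zeta> t * cnj (\<zeta> t))" by (simp add: x_def mult_ac)
      with unit ne show False by simp
    qed
    moreover have "x ^ n = 1" using unit(2)[of t]
      by (simp add: x_def power_mult_distrib unit flip: complex_cnj_power)
    ultimately show ?thesis using False unfolding sum by (simp add: geometric_sum)
  qed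
qed

text \<open>The bound \<open>T \<le> n\<close> keeps all entry indices distinct modulo
  \<open>n\<close>, so the orthogonality applies to every pair of them.\<close>

lemma Sigma_mat_roots_of_unity:
  fixes w :: "real vec" and n T :: nat
  assumes Tn: "T \<le> n" and w: "w \<in> carrier_vec T"
    and z: "\<And>i. i < n \<Longrightarrow> z i = cis (2 * pi * real i / real n)"
    and uRe: "\<And>i. i < n \<Longrightarrow>
      u i = map_vec Re (hadamard_vec (map_vec complex_of_real w) (phi T (z i)))"
    and uIm: "\<And>i. i < n \<Longrightarrow>
      u (n + i) = map_vec Im (hadamard_vec (map_vec complex_of_real w) (phi T (z i)))"
  shows "Sigma_mat T (2 * n) u =
    mat_diag T (\<lambda>a. real n * (\<Sum>l<T - a. (w $ l)\<^sup>2))"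
proof (rule eq_matI)
  fix a b assume "a < dim_row (mat_diag T (\<lambda>a. real n * (\<Sum>l<T - a. (w $ l)\<^sup>2)))"
    and "b < dim_col (mat_diag T (\<lambda>a. real n * (\<Sum>l<T - a. (w $ l)\<^sup>2)))"
  then have ab: "a < T" "b < T" by (auto simp: mat_diag_def)
  have dim: "dim_vec (u k) = T" if "k < 2 * n" for k
  proof (cases "k < n")
    case True
    then show ?thesis using uRe w by (simp add: hadamard_vec_def)
  next
    case False
    then have "k = n + (k - n)" "k - n < n" using that by auto
    then show ?thesis using uIm[of "k - n"] w by (simp add: hadamard_vec_def)
  qed
  have orth: "(\<Sum>k<2 * n. u k $ s * u k $ t) = (if s = t then real n * (w $ s)\<^sup>2 else 0)"
    if st: "s < T" "t < T" for s t
  proof -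
    have concat: "(\<Sum>k<n + b. f k) = (\<Sum>i<n. f i) + (\<Sum>i<b. f (n + i))" for b and f :: "nat \<Rightarrow> real"
      by (induction b) (simp_all add: add.assoc)
    have "(\<Sum>k<2 * n. u k $ s * u k $ t)
        = (\<Sum>i<n. u i $ s * u i $ t) + (\<Sum>i<n. u (n + i) $ s * u (n + i) $ t)"
      by (simp add: mult_2 concat)
    \<comment> \<open>The real and imaginary vectors for the same root combine through Re x Re y +
      Im x Im y = Re (x \<open>cnj\<close> y).\<close>
    also have "\<dots> = (\<Sum>i<n. w $ s * w $ t * Re (z i ^ s * cnj (z i ^ t)))"
      unfolding sum.distrib[symmetric]
    proof (intro sum.cong refl)
      fix i assume "i \<in> {..<n}"
      then show "u i $ s * u i $ t + u (n + i) $ s * u (n + i) $ t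
          = w $ s * w $ t * Re (z i ^ s * cnj (z i ^ t))"
        using st w
        by (simp add: uRe uIm hadamard_vec_def phi_def del: complex_cnj_power)
          (simp add: algebra_simps)
    qed
    also have "\<dots> = w $ s * w $ t * Re (\<Sum>i<n. z i ^ s * cnj (z i ^ t))"
      by (simp add: sum_distrib_left)
    also have "(\<Sum>i<n. z i ^ s * cnj (z i ^ t)) = (if s = t then of_nat n else 0)"
      using sum_roots_of_unity_orthogonal[of s n t] st Tn
      by (simp add: z del: complex_cnj_power cong: sum.cong_simp)
    finally show ?thesis by (simp add: power2_eq_square)
  qed
  \<comment> \<open>Column \<open>a\<close> of \<open>Toep (u k)\<close> carries
    \<open>u k $ (c - a)\<close> in row \<open>c\<close> when \<open>a \<le> c\<close>; the entry is
    the inner product of two such columns.\<close>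
  have "Sigma_mat T (2 * n) u $$ (a, b)
      = (\<Sum>k<2 * n. \<Sum>c<T. (if a \<le> c \<and> b \<le> c then u k $ (c - a) * u k $ (c - b) else 0))"
    unfolding Sigma_mat_def using ab
    by (auto simp: dim Toep_def scalar_prod_def atLeast0LessThan intro!: sum.cong)
  \<comment> \<open>Summing over \<open>k\<close> first lets \<open>orth\<close> act in each row
    \<open>c\<close>: for \<open>a, b \<le> c\<close> the indices \<open>c - a\<close> and
    \<open>c - b\<close> agree only if \<open>a = b\<close>.\<close>
  also have "\<dots> = (\<Sum>c<T. if a \<le> c \<and> b \<le> c then (\<Sum>k<2 * n. u k $ (c - a) * u k $ (c - b)) else 0)"
    by (subst sum.swap) (auto intro!: sum.cong)
  also have "\<dots> = (\<Sum>c<T. if a \<le> c \<and> a = b then real n * (w $ (c - a))\<^sup>2 else 0)"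
    using ab by (intro sum.cong refl) (auto simp: orth)
  also have "\<dots> = (if a = b then (\<Sum>c=a..<T. real n * (w $ (c - a))\<^sup>2) else 0)"
    by (auto intro!: sum.mono_neutral_cong_right)
  also have "(\<Sum>c=a..<T. real n * (w $ (c - a))\<^sup>2) = (\<Sum>l<T - a. real n * (w $ l)\<^sup>2)"
    using ab by (intro sum.reindex_bij_witness[of _ "\<lambda>l. l + a" "\<lambda>c. c - a"]) auto
  finally show "Sigma_mat T (2 * n) u $$ (a, b) = mat_diag T (\<lambda>a. real n * (\<Sum>l<T - a. (w $ l)\<^sup>2)) $$ (a, b)"
    using ab by (simp add: mat_diag_def sum_distrib_left)
qed (auto simp: Sigma_mat_def mat_diag_def)

section \<open>Inverses of diagonal matrices and the value of \<open>mat_inverse\<close>\<close>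

lemma mat_diag_inverse:
  fixes f :: "nat \<Rightarrow> 'a :: field"
  assumes "\<And>i. i < n \<Longrightarrow> f i \<noteq> 0"
  shows "mat_diag n f * mat_diag n (\<lambda>i. inverse (f i)) = 1\<^sub>m n"
    and "mat_diag n (\<lambda>i. inverse (f i)) * mat_diag n f = 1\<^sub>m n"
  unfolding mat_diag_diag using assms by (auto simp: mat_diag_def intro!: eq_matI)

text \<open>The result \<open>None\<close> would say that \<open>A\<close> is not a unit of the
  matrix ring, which \<open>B\<close> refutes; any other result equals \<open>B\<close> by
  uniqueness of inverses.\<close>

lemma mat_inverse_eqI:
  assumes A: "A \<in> carrier_mat n n" and B: "B \<in> carrier_mat n n"
    and AB: "A * B = 1\<^sub>m n" and BA: "B * A = 1\<^sub>m n"
  shows "mat_inverse A = Some B"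
proof (cases "mat_inverse A")
  case None
  have "A \<in> Units (ring_mat TYPE('a) n ())"
    using A B AB BA by (auto simp: Units_def ring_mat_simps)
  with mat_inverse(1)[OF A None, of "()"] show ?thesis by simp
next
  case (Some C)
  from mat_inverse(2)[OF A Some] have C: "C * A = 1\<^sub>m n" "C \<in> carrier_mat n n" by auto
  have "C = C * (A * B)" using C AB by simp
  also have "\<dots> = C * A * B" using A B C by (intro assoc_mult_mat[symmetric])
  also have "\<dots> = B" using B C by simp
  finally show ?thesis using Some by simp
qed

section \<open>The trace formula read off from the diagonal form\<close>

theorem lemma3p9:
  fixes p :: ereal and m n T r :: nat
    and w :: "real vec" and z :: "nat \<Rightarrow> complex" and u :: "nat \<Rightarrow> real vec"
  assumes "2 < p"
    and "0 < m" and "0 < n" and "0 < T" and "0 < r"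
    and "r \<le> T" and "m = 2 * n" and "T \<le> n"
    and "w \<in> carrier_vec T"
    and "lp_norm p w \<le> 1"
    and "(\<Sum>i=1..r. inverse (ereal (\<Sum>l<T - r + i. (w $ l)\<^sup>2))) = D p T r"
    and "\<And>i. i < n \<Longrightarrow> z i = exp (2 * of_real pi * \<i> * of_nat i / of_nat n)"
    and "\<And>i. i < n \<Longrightarrow>
      u i = map_vec Re (hadamard_vec (map_vec complex_of_real w) (phi T (z i)))"
    and "\<And>i. i < n \<Longrightarrow>
      u (n + i) = map_vec Im (hadamard_vec (map_vec complex_of_real w) (phi T (z i)))"
  shows "invertible_mat (Sigma_mat T (2 * n) u) \<and>
    ereal (mat_trace (upper_left r (the (mat_inverse (Sigma_mat T (2 * n) u)))))
      = ereal (2 / real m) * D p T r"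
proof -
  define S where "S k = (\<Sum>l<k. (w $ l)\<^sup>2)" for k
  define d where "d a = real n * S (T - a)" for a
  have w0: "w $ 0 \<noteq> 0"
    using minimizer_first_entry_nonzero[OF assms(1,5,6,9,10,11)] .
  \<comment> \<open>Every nonempty prefix contains index 0, whose square is positive.\<close>
  have S: "0 < S k" if "0 < k" for k
  proof -
    have "(w $ 0)\<^sup>2 \<le> S k"
      unfolding S_def using that by (intro member_le_sum) auto
    with w0 show ?thesis by (smt (verit) zero_less_power2)
  qed
  have d: "d a \<noteq> 0" if "a < T" for a
    using S[of "T - a"] that \<open>0 < n\<close> by (simp add: d_def)
  have "z i = cis (2 * pi * real i / real n)" if "i < n" for i
    using assms(12)[OF that] by (simp add: cis_conv_exp mult_ac)
  then have Sigma: "Sigma_mat T (2 * n) u = mat_diag T d"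
    unfolding d_def S_def
    by (rule Sigma_mat_roots_of_unity[where z = z, OF assms(8,9) _ assms(13) assms(14)])
  note inv = mat_diag_inverse[of T d, OF d]
  have invertible: "invertible_mat (mat_diag T d)"
    unfolding invertible_mat_def inverts_mat_def square_mat.simps
    using inv by (auto simp: mat_diag_def)
  have inverse: "mat_inverse (mat_diag T d) = Some (mat_diag T (\<lambda>a. inverse (d a)))"
    using inv by (intro mat_inverse_eqI[of _ T]) auto
  have trace: "mat_trace (upper_left r (mat_diag T (\<lambda>a. inverse (d a)))) = (\<Sum>a<r. inverse (d a))"
    using assms(6) by (simp add: mat_trace_def upper_left_def mat_diag_def)
  \<comment> \<open>With \<open>i = r - a\<close> and \<open>r \<le> T\<close>, the length
    \<open>T - a\<close> becomes \<open>T - r + i\<close>, the indexing used in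
    \<open>D\<close>.\<close>
  have sum: "(\<Sum>a<r. inverse (d a)) = inverse (real n) * (\<Sum>i=1..r. inverse (S (T - r + i)))"
    unfolding sum_distrib_left d_def using assms(6)
    by (intro sum.reindex_bij_witness[of _ "\<lambda>i. r - i" "\<lambda>a. r - a"]) auto
  \<comment> \<open>Positivity of the prefix sums makes all inverses finite, so the extended-real
    sum is an embedded real one.\<close>
  have D: "D p T r = ereal (\<Sum>i=1..r. inverse (S (T - r + i)))"
  proof -
    have "inverse (ereal (S (T - r + i))) = ereal (inverse (S (T - r + i)))" if "i \<in> {1..r}" for i
      using S[of "T - r + i"] that by simp
    then show ?thesis
      unfolding assms(11)[symmetric] S_def[symmetric] by (simp flip: sum_ereal)
  qed
  have "inverse (real n) = 2 / real m"
    unfolding \<open>m = 2 * n\<close> by (simp add: inverse_eq_divide)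
  then show ?thesis
    unfolding Sigma inverse option.sel trace sum D times_ereal.simps using invertible by simp
qed

end
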